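(* There is an algorithm which, for all integers $K\ge 1$ and $M\ge 1$, with $N=2^K$, on input the $N$ sample values $G\left(e^{i\frac{2\pi m}{N}}\right)\in\mathbb{C}$, $m=0,1,\ldots,N-1$, of a function $G$ on the unit circle, computes all $MN$ values $$\langle G,e_{a_{s,j}}\rangle^{\tilde{}}=\sum_{m=0}^{N-1}\frac{\sqrt{1-r_s^2}}{N}\,G\left(e^{i\frac{2\pi m}{N}}\right)\frac{1}{1-a_{s,j}e^{-i\frac{2\pi m}{N}}},\qquad a_{s,j}=r_s e^{i\frac{2\pi}{N}j},\quad r_s=\frac{s}{M+1},$$ for $s=1,\ldots,M$ and $j=0,1,\ldots,N-1$, and outputs a point $a_{s',j'}$ of this grid such that $$\left|\langle G,e_{a_{s',j'}}\rangle^{\tilde{}}\right|^2=\max_{1\le s\le M,\ 0\le j\le N-1}\left|\langle G,e_{a_{s,j}}\rangle^{\tilde{}}\right|^2,$$ with computational complexity $\mathcal{O}(MN\log_2 N)$.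
   Context: Computational complexity counts the elementary operations on numbers (arithmetic operations on complex numbers and comparisons of absolute values), each at unit cost, and the constant in $\mathcal{O}$ is independent of $M$, $N$ and $G$. $N$ is the number of equispaced discretization points on the unit circle, and $M$ is the number of equispaced sample radii in $(0,1)$. The sum $\langle G,e_a\rangle^{\tilde{}}$ discretizes $\langle G,e_a\rangle=\frac{1}{2\pi}\int_0^{2\pi}G(e^{it})\frac{\sqrt{1-|a|^2}}{1-ae^{-it}}\,dt$ with $e_a(z)=\frac{\sqrt{1-|a|^2}}{1-\overline{a}z}$, $a$ in the open unit disc; the task is one maximal selection step of the one-dimensional adaptive Fourier decomposition. *)

theory Defs
  imports Complex_Main
begin

text \<open>
  Algorithms are programs of a small imperative language.  A state consists of index variables
  (natural numbers, used for addressing and control) and of arrays of complex numbers.  The control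
  flow can depend on the complex data only through comparisons of absolute values, and complex data
  can be modified only by the four arithmetic operations.  Only operations on complex numbers are
  counted; index arithmetic, control and the copying of array cells are free.
\<close>

type_synonym name = string
type_synonym istore = "name \<Rightarrow> nat"
type_synonym cstore = "name \<Rightarrow> nat \<Rightarrow> complex"
type_synonym state = "istore \<times> cstore"

datatype iexp =
    INum nat
  | IVar name
  | IAdd iexp iexp
  | ISub iexp iexp
  | IMul iexp iexp
  | IDiv iexp iexp
  | IMod iexp iexp

primrec ival :: "istore \<Rightarrow> iexp \<Rightarrow> nat" where
  "ival \<sigma> (INum n) = n"
| "ival \<sigma> (IVar x) = \<sigma> x"
| "ival \<sigma> (IAdd e f) = ival \<sigma> e + ival \<sigma> f"
| "ival \<sigma> (ISub e f) = ival \<sigma> e - ival \<sigma> f"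
| "ival \<sigma> (IMul e f) = ival \<sigma> e * ival \<sigma> f"
| "ival \<sigma> (IDiv e f) = ival \<sigma> e div ival \<sigma> f"
| "ival \<sigma> (IMod e f) = ival \<sigma> e mod ival \<sigma> f"

text \<open>
  Besides arithmetic, expressions have three kinds of constants: natural numbers, roots of unity
  \<open>exp (2 \<pi> i p / q)\<close> and square roots \<open>sqrt (p / q)\<close>.  The last two occur in the grid points
  and in the normalising factors and cannot be produced by arithmetic.  Their arguments are index
  expressions, so they cannot be applied to complex data.
\<close>

datatype cexp =
    CCell name iexp
  | CNat iexp
  | CRoot iexp iexp
  | CSqrt iexp iexp
  | CAdd cexp cexp
  | CSub cexp cexp
  | CMul cexp cexp
  | CDiv cexp cexp

primrec cval :: "state \<Rightarrow> cexp \<Rightarrow> complex" where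
  "cval s (CCell A e) = snd s A (ival (fst s) e)"
| "cval s (CNat e) = of_nat (ival (fst s) e)"
| "cval s (CRoot p q) = cis (2 * pi * real (ival (fst s) p) / real (ival (fst s) q))"
| "cval s (CSqrt p q) = complex_of_real (sqrt (real (ival (fst s) p) / real (ival (fst s) q)))"
| "cval s (CAdd x y) = cval s x + cval s y"
| "cval s (CSub x y) = cval s x - cval s y"
| "cval s (CMul x y) = cval s x * cval s y"
| "cval s (CDiv x y) = cval s x / cval s y"

text \<open>
  A program gets stuck on a division by zero instead of using the convention \<open>x / 0 = 0\<close>, which
  would provide an uncounted test for zero.
\<close>

primrec cdefined :: "state \<Rightarrow> cexp \<Rightarrow> bool" where
  "cdefined s (CCell A e) = True"
| "cdefined s (CNat e) = True"
| "cdefined s (CRoot p q) = (ival (fst s) q \<noteq> 0)"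
| "cdefined s (CSqrt p q) = (ival (fst s) q \<noteq> 0)"
| "cdefined s (CAdd x y) = (cdefined s x \<and> cdefined s y)"
| "cdefined s (CSub x y) = (cdefined s x \<and> cdefined s y)"
| "cdefined s (CMul x y) = (cdefined s x \<and> cdefined s y)"
| "cdefined s (CDiv x y) = (cdefined s x \<and> cdefined s y \<and> cval s y \<noteq> 0)"

text \<open>Every arithmetic operation and every generation of a constant costs one unit.\<close>

primrec ccost :: "cexp \<Rightarrow> nat" where
  "ccost (CCell A e) = 0"
| "ccost (CNat e) = 1"
| "ccost (CRoot p q) = 1"
| "ccost (CSqrt p q) = 1"
| "ccost (CAdd x y) = ccost x + ccost y + 1"
| "ccost (CSub x y) = ccost x + ccost y + 1"
| "ccost (CMul x y) = ccost x + ccost y + 1"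
| "ccost (CDiv x y) = ccost x + ccost y + 1"

datatype bexp =
    BIdxEq iexp iexp
  | BIdxLess iexp iexp
  | BAbsLess cexp cexp
  | BNot bexp
  | BAnd bexp bexp

primrec bval :: "state \<Rightarrow> bexp \<Rightarrow> bool" where
  "bval s (BIdxEq e f) = (ival (fst s) e = ival (fst s) f)"
| "bval s (BIdxLess e f) = (ival (fst s) e < ival (fst s) f)"
| "bval s (BAbsLess x y) = (cmod (cval s x) < cmod (cval s y))"
| "bval s (BNot b) = (\<not> bval s b)"
| "bval s (BAnd b c) = (bval s b \<and> bval s c)"

primrec bdefined :: "state \<Rightarrow> bexp \<Rightarrow> bool" where
  "bdefined s (BIdxEq e f) = True"
| "bdefined s (BIdxLess e f) = True"
| "bdefined s (BAbsLess x y) = (cdefined s x \<and> cdefined s y)"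
| "bdefined s (BNot b) = bdefined s b"
| "bdefined s (BAnd b c) = (bdefined s b \<and> bdefined s c)"

primrec bcost :: "bexp \<Rightarrow> nat" where
  "bcost (BIdxEq e f) = 0"
| "bcost (BIdxLess e f) = 0"
| "bcost (BAbsLess x y) = ccost x + ccost y + 1"
| "bcost (BNot b) = bcost b"
| "bcost (BAnd b c) = bcost b + bcost c"

datatype com =
    Skip
  | IAssign name iexp
  | CAssign name iexp cexp
  | Seq com com
  | Cond bexp com com
  | While bexp com

text \<open>
  \<open>runs P s n t\<close>: started in state \<open>s\<close>, the program \<open>P\<close> terminates in state \<open>t\<close> after \<open>n\<close>
  counted operations.
\<close>

inductive runs :: "com \<Rightarrow> state \<Rightarrow> nat \<Rightarrow> state \<Rightarrow> bool" where
  Skip: "runs Skip s 0 s"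
| IAssign: "runs (IAssign x e) (\<sigma>, \<mu>) 0 (\<sigma>(x := ival \<sigma> e), \<mu>)"
| CAssign: "cdefined (\<sigma>, \<mu>) c \<Longrightarrow>
    runs (CAssign A e c) (\<sigma>, \<mu>) (ccost c)
      (\<sigma>, \<mu>(A := (\<mu> A)(ival \<sigma> e := cval (\<sigma>, \<mu>) c)))"
| Seq: "runs P s n t \<Longrightarrow> runs Q t m u \<Longrightarrow> runs (Seq P Q) s (n + m) u"
| CondTrue: "bdefined s b \<Longrightarrow> bval s b \<Longrightarrow> runs P s n t \<Longrightarrow> runs (Cond b P Q) s (bcost b + n) t"
| CondFalse: "bdefined s b \<Longrightarrow> \<not> bval s b \<Longrightarrow> runs Q s n t \<Longrightarrow> runs (Cond b P Q) s (bcost b + n) t"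
| WhileFalse: "bdefined s b \<Longrightarrow> \<not> bval s b \<Longrightarrow> runs (While b P) s (bcost b) s"
| WhileTrue: "bdefined s b \<Longrightarrow> bval s b \<Longrightarrow> runs P s n t \<Longrightarrow> runs (While b P) t m u \<Longrightarrow>
    runs (While b P) s (bcost b + n + m) u"

inductive_cases SkipE: "runs Skip s n t"
inductive_cases IAssignE: "runs (IAssign x e) s n t"
inductive_cases CAssignE: "runs (CAssign A e c) s n t"
inductive_cases SeqE: "runs (Seq P Q) s n t"
inductive_cases CondE: "runs (Cond b P Q) s n t"
inductive_cases WhileE: "runs (While b P) s n t"

lemma runs_deterministic:
  "runs P s n t \<Longrightarrow> runs P s n' t' \<Longrightarrow> n' = n \<and> t' = t"
proof (induction arbitrary: n' t' rule: runs.induct)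
  case (Skip s)
  then show ?case by (blast elim: SkipE)
next
  case (IAssign x e \<sigma> \<mu>)
  then show ?case by (rule IAssignE) simp
next
  case (CAssign \<sigma> \<mu> c A e)
  from CAssign.prems show ?case by (rule CAssignE) simp
next
  case (Seq P s n t Q m u)
  from Seq.prems show ?case by (rule SeqE) (metis Seq.IH)
next
  case (CondTrue s b P n t Q)
  from CondTrue.prems show ?case
    by (rule CondE) (use CondTrue.hyps CondTrue.IH in blast)+
next
  case (CondFalse s b Q n t P)
  from CondFalse.prems show ?case
    by (rule CondE) (use CondFalse.hyps CondFalse.IH in blast)+
next
  case (WhileFalse s b P)
  from WhileFalse.prems show ?case
    by (rule WhileE) (use WhileFalse.hyps in blast)+
next
  case (WhileTrue s b P n t m u)
  from WhileTrue.prems show ?case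
  proof (rule WhileE)
    assume "\<not> bval s b"
    with WhileTrue.hyps show ?thesis by simp
  next
    fix k v l
    assume "n' = bcost b + k + l" "runs P s k v" "runs (While b P) v l t'"
    with WhileTrue.IH show ?thesis by metis
  qed
qed

text \<open>
  The same program receives all inputs: \<open>K\<close> and \<open>M\<close> in index variables and the \<open>2 ^ K\<close> samples
  in array \<open>G\<close>; everything else is zero.
\<close>

definition input_state :: "nat \<Rightarrow> nat \<Rightarrow> (nat \<Rightarrow> complex) \<Rightarrow> state" where
  "input_state K M g =
     ((\<lambda>_. 0)(''K'' := K, ''M'' := M),
      (\<lambda>_ _. 0)(''G'' := (\<lambda>m. if m < 2 ^ K then g m else 0)))"

definition node :: "nat \<Rightarrow> nat \<Rightarrow> complex" where
  "node N m = cis (2 * pi * real m / real N)"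

definition radius :: "nat \<Rightarrow> nat \<Rightarrow> real" where
  "radius M s = real s / (real M + 1)"

definition grid_point :: "nat \<Rightarrow> nat \<Rightarrow> nat \<Rightarrow> nat \<Rightarrow> complex" where
  "grid_point M N s j = complex_of_real (radius M s) * cis (2 * pi / real N * real j)"

definition discrete_inner :: "(complex \<Rightarrow> complex) \<Rightarrow> nat \<Rightarrow> nat \<Rightarrow> nat \<Rightarrow> nat \<Rightarrow> complex" where
  "discrete_inner G M N s j =
     (\<Sum>m = 0..<N. complex_of_real (sqrt (1 - (radius M s)\<^sup>2) / real N) * G (node N m)
        * (1 / (1 - grid_point M N s j * cis (- (2 * pi * real m / real N)))))"

end

theory Submission
  imports Defs
begin

text \<open>
  For fixed \<open>s\<close> the values are the circular convolution of the samples with the kernel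
  \<open>1 / (1 - r \<omega>\<^sup>j)\<close>, where \<open>\<omega>\<close> is the primitive \<open>N\<close>-th root of unity and \<open>r = r\<^sub>s\<close>.  The Fourier
  transform of this kernel is explicit: if \<open>z = r \<omega>\<^sup>j \<omega>\<^bsup>-m\<^esup>\<close> then \<open>z\<^sup>N = r\<^sup>N\<close>, and a finite geometric sum gives
  \<open>1 / (1 - z) = (\<Sum>l<N. z\<^sup>l) / (1 - r\<^sup>N)\<close>.  Hence (\<open>discrete_inner_eq_dft\<close>) the values on the circle
  of radius \<open>r\<close> are the discrete Fourier transform of the sequence \<open>c r\<^sup>l \<gamma>\<^sub>l\<close>, where \<open>\<gamma>\<^sub>l\<close> is the
  conjugate transform of the samples and \<open>c = sqrt (1 - r\<^sup>2) / (N (1 - r\<^sup>N))\<close>.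

  The program transforms the samples once and then, for every radius, computes the powers of \<open>r\<close>,
  multiplies, and applies one more fast Fourier transform (\<open>filter_circle_correct\<close>).  A transform
  costs \<open>3 K N\<close> operations (\<open>fft_correct\<close>) and the rest of the work for one radius is linear in \<open>N\<close>.
  A linear search through the \<open>M N\<close> values ends the selection step (\<open>find_maximum_correct\<close>).  Since
  \<open>K = log\<^sub>2 N \<ge> 1\<close>, all lower order terms are absorbed in the constant 25.

  Programs are verified with total correctness statements that carry a cost bound.  Everything a
  program does not write is known to be unchanged, so that specifications mention only what changes.
\<close>

section \<open>Programs with a cost bound\<close>

text \<open>
  Total correctness with cost: started in \<open>(\<sigma>, \<mu>)\<close>, the program \<open>P\<close> terminates after at most \<open>k\<close>
  counted operations in a state that satisfies \<open>Q\<close>.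
\<close>

definition ends_within ::
  "com \<Rightarrow> nat \<Rightarrow> (istore \<Rightarrow> cstore \<Rightarrow> bool) \<Rightarrow> istore \<Rightarrow> cstore \<Rightarrow> bool" where
  "ends_within P k Q \<sigma> \<mu> \<longleftrightarrow> (\<exists>n \<sigma>' \<mu>'. runs P (\<sigma>, \<mu>) n (\<sigma>', \<mu>') \<and> n \<le> k \<and> Q \<sigma>' \<mu>')"

text \<open>
  Syntactic over-approximations of the index variables and the arrays that a program modifies.
\<close>

primrec index_writes :: "com \<Rightarrow> name set" where
  "index_writes Skip = {}"
| "index_writes (IAssign x e) = {x}"
| "index_writes (CAssign A e c) = {}"
| "index_writes (Seq P Q) = index_writes P \<union> index_writes Q"
| "index_writes (Cond b P Q) = index_writes P \<union> index_writes Q"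
| "index_writes (While b P) = index_writes P"

primrec array_writes :: "com \<Rightarrow> name set" where
  "array_writes Skip = {}"
| "array_writes (IAssign x e) = {}"
| "array_writes (CAssign A e c) = {A}"
| "array_writes (Seq P Q) = array_writes P \<union> array_writes Q"
| "array_writes (Cond b P Q) = array_writes P \<union> array_writes Q"
| "array_writes (While b P) = array_writes P"

text \<open>
  The states \<open>(\<sigma>, \<mu>)\<close> and \<open>(\<sigma>', \<mu>')\<close> agree outside the variables and arrays that \<open>P\<close> writes.
\<close>

definition unchanged :: "com \<Rightarrow> istore \<Rightarrow> cstore \<Rightarrow> istore \<Rightarrow> cstore \<Rightarrow> bool" where
  "unchanged P \<sigma> \<mu> \<sigma>' \<mu>' \<longleftrightarrow>
     (\<forall>x. x \<notin> index_writes P \<longrightarrow> \<sigma>' x = \<sigma> x) \<and> (\<forall>A. A \<notin> array_writes P \<longrightarrow> \<mu>' A = \<mu> A)"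

lemma runs_frame:
  "runs P s n t \<Longrightarrow> unchanged P (fst s) (snd s) (fst t) (snd t)"
  by (induction rule: runs.induct) (auto simp: unchanged_def)

lemma ends_within_frame:
  assumes "ends_within P k Q \<sigma> \<mu>"
  shows "ends_within P k (\<lambda>\<sigma>' \<mu>'. Q \<sigma>' \<mu>' \<and> unchanged P \<sigma> \<mu> \<sigma>' \<mu>') \<sigma> \<mu>"
  using assms runs_frame unfolding ends_within_def by fastforce

lemma ends_within_weaken:
  assumes "ends_within P k Q \<sigma> \<mu>"
    and "\<And>\<sigma>' \<mu>'. Q \<sigma>' \<mu>' \<Longrightarrow> unchanged P \<sigma> \<mu> \<sigma>' \<mu>' \<Longrightarrow> R \<sigma>' \<mu>'" and "k \<le> k'"
  shows "ends_within P k' R \<sigma> \<mu>"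
  using ends_within_frame[OF assms(1)] assms(2,3) le_trans unfolding ends_within_def by meson

lemma ends_within_Skip: "Q \<sigma> \<mu> \<Longrightarrow> ends_within Skip k Q \<sigma> \<mu>"
  unfolding ends_within_def using runs.Skip by blast

lemma ends_within_IAssign:
  "Q (\<sigma>(x := ival \<sigma> e)) \<mu> \<Longrightarrow> ends_within (IAssign x e) k Q \<sigma> \<mu>"
  unfolding ends_within_def using runs.IAssign by blast

lemma ends_within_CAssign:
  assumes "cdefined (\<sigma>, \<mu>) c" and "ccost c \<le> k"
    and "Q \<sigma> (\<mu>(A := (\<mu> A)(ival \<sigma> e := cval (\<sigma>, \<mu>) c)))"
  shows "ends_within (CAssign A e c) k Q \<sigma> \<mu>"
  unfolding ends_within_def using runs.CAssign[OF assms(1)] assms(2,3) by blast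

lemma ends_within_Seq:
  assumes "ends_within P k Q \<sigma> \<mu>"
    and "\<And>\<sigma>' \<mu>'. Q \<sigma>' \<mu>' \<Longrightarrow> unchanged P \<sigma> \<mu> \<sigma>' \<mu>' \<Longrightarrow> ends_within P' l R \<sigma>' \<mu>'"
  shows "ends_within (Seq P P') (k + l) R \<sigma> \<mu>"
  using ends_within_frame[OF assms(1)] assms(2) unfolding ends_within_def
  by (metis add_mono runs.Seq)

lemma ends_within_IAssign_Seq:
  assumes "ends_within P k R (\<sigma>(x := ival \<sigma> e)) \<mu>"
  shows "ends_within (Seq (IAssign x e) P) k R \<sigma> \<mu>"
  using assms runs.Seq[OF runs.IAssign] unfolding ends_within_def by fastforce

lemma ends_within_CAssign_Seq:
  assumes "cdefined (\<sigma>, \<mu>) c" and "ccost c = k"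
    and "ends_within P l R \<sigma> (\<mu>(A := (\<mu> A)(ival \<sigma> e := cval (\<sigma>, \<mu>) c)))"
  shows "ends_within (Seq (CAssign A e c) P) (k + l) R \<sigma> \<mu>"
  using assms(2,3) runs.Seq[OF runs.CAssign[OF assms(1)]] unfolding ends_within_def
  by (metis add_left_mono)

lemma ends_within_Cond:
  assumes "bdefined (\<sigma>, \<mu>) b" and "bcost b + l \<le> k"
    and "bval (\<sigma>, \<mu>) b \<Longrightarrow> ends_within P l Q \<sigma> \<mu>"
    and "\<not> bval (\<sigma>, \<mu>) b \<Longrightarrow> ends_within P' l Q \<sigma> \<mu>"
  shows "ends_within (Cond b P P') k Q \<sigma> \<mu>"
proof (cases "bval (\<sigma>, \<mu>) b")
  case True
  then obtain n \<sigma>' \<mu>' where "runs P (\<sigma>, \<mu>) n (\<sigma>', \<mu>')" "n \<le> l" "Q \<sigma>' \<mu>'"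
    using assms(3) unfolding ends_within_def by blast
  with runs.CondTrue[OF assms(1) True] assms(2) show ?thesis
    unfolding ends_within_def by (meson add_left_mono le_trans)
next
  case False
  then obtain n \<sigma>' \<mu>' where "runs P' (\<sigma>, \<mu>) n (\<sigma>', \<mu>')" "n \<le> l" "Q \<sigma>' \<mu>'"
    using assms(4) unfolding ends_within_def by blast
  with runs.CondFalse[OF assms(1) False] assms(2) show ?thesis
    unfolding ends_within_def by (meson add_left_mono le_trans)
qed

text \<open>
  The loop that executes \<open>P\<close> with \<open>x = 0, 1, \<dots>, y - 1\<close>.  The bound is an index variable; the loop
  control is free of cost.
\<close>

definition for_loop :: "name \<Rightarrow> name \<Rightarrow> com \<Rightarrow> com" where
  "for_loop x y P = Seq (IAssign x (INum 0))
     (While (BIdxLess (IVar x) (IVar y)) (Seq P (IAssign x (IAdd (IVar x) (INum 1)))))"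

lemma writes_for_loop [simp]:
  "index_writes (for_loop x y P) = insert x (index_writes P)"
  "array_writes (for_loop x y P) = array_writes P"
  by (auto simp: for_loop_def)

text \<open>
  Rule for loops with invariant \<open>I\<close>, whose first argument is the number of completed iterations.  The
  invariant need not repeat facts about variables and arrays outside the loop's writes, because each
  iteration may assume that they have their values from before the loop.
\<close>

lemma ends_within_for_loop:
  assumes x: "x \<notin> index_writes P" and y: "y \<notin> insert x (index_writes P)"
    and n: "\<sigma> y = n"
    and init: "I 0 (\<sigma>(x := 0)) \<mu>"
    and step: "\<And>i \<sigma>' \<mu>'. i < n \<Longrightarrow> \<sigma>' x = i \<Longrightarrow> unchanged (for_loop x y P) \<sigma> \<mu> \<sigma>' \<mu>' \<Longrightarrow>
      I i \<sigma>' \<mu>' \<Longrightarrow> ends_within P k (\<lambda>\<tau> \<nu>. I (Suc i) (\<tau>(x := Suc i)) \<nu>) \<sigma>' \<mu>'"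
  shows "ends_within (for_loop x y P) (n * k) (I n) \<sigma> \<mu>"
proof -
  let ?W = "While (BIdxLess (IVar x) (IVar y)) (Seq P (IAssign x (IAdd (IVar x) (INum 1))))"
  \<comment> \<open>Induction on the number \<open>j\<close> of iterations that remain.\<close>
  have loop: "ends_within ?W (j * k) (I n) \<sigma>' \<mu>'"
    if "j \<le> n" "\<sigma>' x = n - j" "unchanged (for_loop x y P) \<sigma> \<mu> \<sigma>' \<mu>'" "I (n - j) \<sigma>' \<mu>'"
    for j \<sigma>' \<mu>'
    using that
  proof (induction j arbitrary: \<sigma>' \<mu>')
    case 0
    have "\<sigma>' y = n" using 0(3) y n by (auto simp: unchanged_def)
    then have "runs ?W (\<sigma>', \<mu>') (bcost (BIdxLess (IVar x) (IVar y))) (\<sigma>', \<mu>')"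
      using 0 by (intro runs.WhileFalse) auto
    then show ?case using 0 unfolding ends_within_def by force
  next
    case (Suc j)
    let ?i = "n - Suc j"
    have y': "\<sigma>' y = n" using Suc.prems(3) y n by (auto simp: unchanged_def)
    have i: "?i < n" "Suc ?i = n - j" using Suc.prems by auto
    obtain m \<tau> \<nu> where run: "runs P (\<sigma>', \<mu>') m (\<tau>, \<nu>)" and m: "m \<le> k"
      and I: "I (Suc ?i) (\<tau>(x := Suc ?i)) \<nu>"
      using step[OF i(1) Suc.prems(2-4)] unfolding ends_within_def by blast
    have fr: "unchanged P \<sigma>' \<mu>' \<tau> \<nu>" using runs_frame[OF run] by simp
    have \<tau>x: "\<tau> x = ?i" using fr x Suc.prems(2) by (auto simp: unchanged_def)
    define \<rho> where "\<rho> = \<tau>(x := Suc ?i)"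
    have body: "runs (Seq P (IAssign x (IAdd (IVar x) (INum 1)))) (\<sigma>', \<mu>') (m + 0)
        (\<rho>, \<nu>)"
      using runs.Seq[OF run runs.IAssign[of x "IAdd (IVar x) (INum 1)" \<tau> \<nu>]] \<tau>x by (simp add: \<rho>_def)
    have "unchanged (for_loop x y P) \<sigma> \<mu> \<rho> \<nu>"
      using fr Suc.prems(3) by (auto simp: unchanged_def \<rho>_def)
    moreover have "\<rho> x = n - j" "I (n - j) \<rho> \<nu>" using I i(2) by (simp_all only: \<rho>_def fun_upd_same)
    ultimately have "ends_within ?W (j * k) (I n) \<rho> \<nu>"
      using Suc.IH Suc.prems(1) by simp
    then obtain l \<sigma>'' \<mu>'' where rest: "runs ?W (\<rho>, \<nu>) l (\<sigma>'', \<mu>'')"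
      and l: "l \<le> j * k" and fin: "I n \<sigma>'' \<mu>''"
      unfolding ends_within_def by blast
    have "runs ?W (\<sigma>', \<mu>') (bcost (BIdxLess (IVar x) (IVar y)) + (m + 0) + l) (\<sigma>'', \<mu>'')"
      using Suc.prems y' i by (intro runs.WhileTrue[OF _ _ body rest]) auto
    then show ?case using m l fin unfolding ends_within_def
      by (intro exI[of _ "bcost (BIdxLess (IVar x) (IVar y)) + (m + 0) + l"]) auto
  qed
  have "ends_within ?W (n * k) (I n) (\<sigma>(x := 0)) \<mu>"
    using loop[of n "\<sigma>(x := 0)" \<mu>] init by (auto simp: unchanged_def)
  then have "ends_within (for_loop x y P) (n * k) (I n) \<sigma> \<mu>"
    unfolding for_loop_def by (intro ends_within_IAssign_Seq) simp
  then show ?thesis by simp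
qed

section \<open>Roots of unity and the fast Fourier transform\<close>

lemma node_0 [simp]: "node N 0 = 1"
  by (simp add: node_def)

lemma node_add: "node N (a + b) = node N a * node N b"
  by (simp add: node_def cis_mult add_divide_distrib distrib_left)

lemma node_mult: "node N (a * b) = node N a ^ b"
  by (simp add: node_def Complex.DeMoivre algebra_simps)

lemma node_scale: "c > 0 \<Longrightarrow> node (c * N) (c * a) = node N a"
  by (simp add: node_def mult.left_commute[of _ "real c"])

lemma node_self: "node N N = 1"
  by (cases "N = 0") (simp_all add: node_def)

lemma node_period: "N dvd a \<Longrightarrow> node N a = 1"
  by (auto simp: node_mult node_self elim!: dvdE)

lemma node_mod: "node N (m * (a mod N)) = node N (m * a)"
proof -
  have "node N (m * a) = node N (m * (a mod N) + m * (N * (a div N)))"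
    by (metis distrib_left mod_mult_div_eq)
  then show ?thesis by (simp add: node_add node_period)
qed

text \<open>
  The unnormalised discrete Fourier transform with the sign \<open>+\<close> in the exponent; the conjugate
  transform is read off at the reflected index \<open>(N - l) mod N\<close>.
\<close>

definition dft :: "nat \<Rightarrow> (nat \<Rightarrow> complex) \<Rightarrow> nat \<Rightarrow> complex" where
  "dft N x i = (\<Sum>m<N. x m * node N (m * i))"

text \<open>
  The content of cell \<open>i\<close> after \<open>d\<close> levels of the transform of length \<open>2 ^ K\<close>.  With \<open>p = i div 2 ^ d\<close>
  and \<open>q = i mod 2 ^ d\<close>, it is the value at \<open>q\<close> of the transform of length \<open>2 ^ d\<close> of the subsequence
  of \<open>x\<close> with offset \<open>p\<close> and stride \<open>2 ^ (K - d)\<close>.  This layout needs no bit reversal.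
\<close>

definition partial_dft :: "nat \<Rightarrow> (nat \<Rightarrow> complex) \<Rightarrow> nat \<Rightarrow> nat \<Rightarrow> complex" where
  "partial_dft K x d i = dft (2 ^ d) (\<lambda>m. x (i div 2 ^ d + 2 ^ (K - d) * m)) i"

lemma partial_dft_0: "partial_dft K x 0 i = x i"
  by (simp add: partial_dft_def dft_def)

lemma partial_dft_final: "i < 2 ^ K \<Longrightarrow> partial_dft K x K i = dft (2 ^ K) x i"
  by (simp add: partial_dft_def)

lemma dft_double:
  "dft (2 * N) x i = dft N (\<lambda>m. x (2 * m)) i + node (2 * N) i * dft N (\<lambda>m. x (2 * m + 1)) i"
proof -
  have split: "(\<Sum>m<2 * N. f m) = (\<Sum>m<N. f (2 * m)) + (\<Sum>m<N. f (2 * m + 1))"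
    for f :: "nat \<Rightarrow> complex"
    by (induction N) (auto simp: algebra_simps)
  have ev: "node (2 * N) (2 * m * i) = node N (m * i)" for m
    using node_scale[of 2 N "m * i"] by (simp add: mult.assoc)
  have od: "node (2 * N) ((2 * m + 1) * i) = node (2 * N) i * node N (m * i)" for m
    using ev[of m] by (simp add: node_add distrib_right)
  show ?thesis
    unfolding dft_def split ev od by (simp add: sum_distrib_left algebra_simps)
qed

lemma dft_cong_mod: "a mod N = b mod N \<Longrightarrow> dft N x a = dft N x b"
  unfolding dft_def by (metis node_mod)

text \<open>
  The first of the two cells of level \<open>d\<close>, with \<open>D = 2 ^ d\<close>, from which cell \<open>i\<close> of the next level is
  computed; the second one lies half the total length above it.
\<close>

definition butterfly :: "nat \<Rightarrow> nat \<Rightarrow> nat" where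
  "butterfly D i = i div (2 * D) * D + i mod D"

lemma butterfly_bound:
  assumes "d < K" "i < 2 ^ K"
  shows "butterfly (2 ^ d) i + 2 ^ K div 2 < 2 ^ K"
proof -
  obtain e where K: "K = Suc (d + e)" using assms(1) less_imp_Suc_add by blast
  have "i div (2 * 2 ^ d) < 2 ^ e"
    using assms(2) by (simp add: K power_add less_mult_imp_div_less mult_ac)
  then have "Suc (i div (2 * 2 ^ d)) * 2 ^ d \<le> 2 ^ e * 2 ^ d"
    by (intro mult_right_mono) auto
  moreover have "i mod 2 ^ d < 2 ^ d" by simp
  ultimately have "i div (2 * 2 ^ d) * 2 ^ d + i mod 2 ^ d < 2 ^ e * 2 ^ d" by (simp del: mod_less_divisor)
  then show ?thesis by (simp add: butterfly_def K power_add mult_ac)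
qed

lemma partial_dft_Suc:
  assumes "d < K" "i < 2 ^ K"
  shows "partial_dft K x (Suc d) i = partial_dft K x d (butterfly (2 ^ d) i) +
           node (2 * 2 ^ d) i * partial_dft K x d (butterfly (2 ^ d) i + 2 ^ K div 2)"
proof -
  obtain e where K: "K = Suc (d + e)" using assms(1) less_imp_Suc_add by blast
  let ?u = "butterfly (2 ^ d) i" and ?p = "i div (2 * 2 ^ d)"
  have half: "2 ^ K div 2 = 2 ^ e * (2 ^ d :: nat)" by (simp add: K power_add mult_ac)
  have q: "?u div 2 ^ d = ?p" "(?u + 2 ^ K div 2) div 2 ^ d = ?p + 2 ^ e"
    unfolding half by (simp_all add: butterfly_def)
  have r: "?u mod 2 ^ d = i mod 2 ^ d" "(?u + 2 ^ K div 2) mod 2 ^ d = i mod 2 ^ d"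
    unfolding half by (simp_all add: butterfly_def)
  have e: "K - d = Suc e" "K - Suc d = e" by (simp_all add: K)
  show ?thesis
    unfolding partial_dft_def q dft_cong_mod[OF r(1)] dft_cong_mod[OF r(2)] e power_Suc dft_double
    by (simp add: algebra_simps)
qed

abbreviation butterfly_exp :: iexp where
  "butterfly_exp \<equiv> IAdd (IMul (IDiv (IVar ''i'') (IMul (INum 2) (IVar ''D''))) (IVar ''D''))
     (IMod (IVar ''i'') (IVar ''D''))"

text \<open>
  One level of the transform.  Level \<open>d\<close> occupies the cells \<open>d * N, \<dots>, d * N + N - 1\<close> of the array
  \<open>F\<close>, so a level never overwrites the data that it reads.
\<close>

definition fft_level :: com where
  "fft_level = for_loop ''i'' ''N'' (CAssign ''F''
     (IAdd (IMul (IAdd (IVar ''d'') (INum 1)) (IVar ''N'')) (IVar ''i''))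
     (CAdd (CCell ''F'' (IAdd (IMul (IVar ''d'') (IVar ''N'')) butterfly_exp))
       (CMul (CRoot (IVar ''i'') (IMul (INum 2) (IVar ''D'')))
         (CCell ''F'' (IAdd (IMul (IVar ''d'') (IVar ''N''))
           (IAdd butterfly_exp (IDiv (IVar ''N'') (INum 2))))))))"

text \<open>
  The transform reads its input in the first \<open>N\<close> cells of \<open>F\<close> and leaves the result in the cells
  from \<open>K * N\<close> on.  The variable \<open>D\<close> holds \<open>2 ^ d\<close>.
\<close>

definition fft :: com where
  "fft = Seq (IAssign ''D'' (INum 1))
     (for_loop ''d'' ''K'' (Seq fft_level (IAssign ''D'' (IMul (INum 2) (IVar ''D'')))))"

lemma fft_writes [simp]:
  "index_writes fft_level = {''i''}" "array_writes fft_level = {''F''}"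
  "index_writes fft = {''D'', ''d'', ''i''}" "array_writes fft = {''F''}"
  by (auto simp: fft_level_def fft_def)

lemma fft_level_correct:
  assumes d: "\<sigma> ''d'' = d" "d < K" and N: "\<sigma> ''N'' = 2 ^ K" and D: "\<sigma> ''D'' = 2 ^ d"
    and F: "\<And>i. i < 2 ^ K \<Longrightarrow> \<mu> ''F'' (d * 2 ^ K + i) = partial_dft K x d i"
  shows "ends_within fft_level (2 ^ K * 3)
    (\<lambda>\<sigma>' \<mu>'. \<forall>i<2 ^ K. \<mu>' ''F'' (Suc d * 2 ^ K + i) = partial_dft K x (Suc d) i) \<sigma> \<mu>"
proof -
  define I where "I i \<sigma>' \<mu>' \<longleftrightarrow>
      (\<forall>u<2 ^ K. \<mu>' ''F'' (d * 2 ^ K + u) = partial_dft K x d u) \<and>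
      (\<forall>u<i. \<mu>' ''F'' (Suc d * 2 ^ K + u) = partial_dft K x (Suc d) u)"
    for i and \<sigma>' :: istore and \<mu>' :: cstore
  have "ends_within fft_level (2 ^ K * 3) (I (2 ^ K)) \<sigma> \<mu>"
    unfolding fft_level_def
  proof (rule ends_within_for_loop, goal_cases)
    case (5 i \<tau> \<nu>)
    then have v: "\<tau> ''N'' = 2 ^ K" "\<tau> ''d'' = d" "\<tau> ''D'' = 2 ^ d" "\<tau> ''i'' = i"
      using d N D by (auto simp: unchanged_def)
    let ?u = "butterfly (2 ^ d) i"
    have u: "?u + 2 ^ K div 2 < 2 ^ K" by (rule butterfly_bound) (use d 5 in auto)
    have F': "\<nu> ''F'' (d * 2 ^ K + ?u) = partial_dft K x d ?u"
      "\<nu> ''F'' (d * 2 ^ K + (?u + 2 ^ K div 2)) = partial_dft K x d (?u + 2 ^ K div 2)"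
      using 5 u by (auto simp: I_def)
    have val: "partial_dft K x (Suc d) i = \<nu> ''F'' (d * 2 ^ K + ?u) +
        cis (2 * pi * real i / real (2 * 2 ^ d)) * \<nu> ''F'' (d * 2 ^ K + (?u + 2 ^ K div 2))"
      unfolding F' using partial_dft_Suc[OF d(2)] 5(1) by (simp add: node_def)
    show ?case
    proof (rule ends_within_CAssign)
      show "I (Suc i) (\<tau>(''i'' := Suc i)) (\<nu>(''F'' := (\<nu> ''F'')
        (ival \<tau> (IAdd (IMul (IAdd (IVar ''d'') (INum 1)) (IVar ''N'')) (IVar ''i'')) :=
         cval (\<tau>, \<nu>) (CAdd (CCell ''F'' (IAdd (IMul (IVar ''d'') (IVar ''N'')) butterfly_exp))
       (CMul (CRoot (IVar ''i'') (IMul (INum 2) (IVar ''D'')))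
         (CCell ''F'' (IAdd (IMul (IVar ''d'') (IVar ''N''))
           (IAdd butterfly_exp (IDiv (IVar ''N'') (INum 2))))))))))"
        using 5(4) val by (auto simp: I_def v butterfly_def less_Suc_eq)
    qed (auto simp: v)
  qed (use N F in \<open>auto simp: I_def\<close>)
  then show ?thesis
    by (rule ends_within_weaken) (auto simp: I_def)
qed

lemma fft_correct:
  assumes K: "\<sigma> ''K'' = K" and N: "\<sigma> ''N'' = 2 ^ K"
    and x: "\<And>i. i < 2 ^ K \<Longrightarrow> \<mu> ''F'' i = x i"
  shows "ends_within fft (3 * K * 2 ^ K)
           (\<lambda>\<sigma>' \<mu>'. \<forall>i<2 ^ K. \<mu>' ''F'' (K * 2 ^ K + i) = dft (2 ^ K) x i) \<sigma> \<mu>"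
proof -
  define I where "I d \<sigma>' \<mu>' \<longleftrightarrow> \<sigma>' ''D'' = (2::nat) ^ d \<and>
      (\<forall>i<2 ^ K. \<mu>' ''F'' (d * 2 ^ K + i) = partial_dft K x d i)"
    for d and \<sigma>' :: istore and \<mu>' :: cstore
  have "ends_within fft (K * (2 ^ K * 3 + 0)) (I K) \<sigma> \<mu>"
    unfolding fft_def
  proof (rule ends_within_IAssign_Seq, rule ends_within_for_loop, goal_cases)
    case (5 d \<tau> \<nu>)
    then have v: "\<tau> ''N'' = 2 ^ K" "\<tau> ''d'' = d" "\<tau> ''D'' = 2 ^ d"
      and F: "\<And>i. i < 2 ^ K \<Longrightarrow> \<nu> ''F'' (d * 2 ^ K + i) = partial_dft K x d i"
      using N by (auto simp: unchanged_def I_def)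
    show ?case
      by (rule ends_within_Seq[OF fft_level_correct[where x = x and \<mu> = \<nu>, OF v(2) 5(1) v(1,3) F]])
        (auto intro!: ends_within_IAssign simp: I_def unchanged_def v)
  qed (use K x in \<open>auto simp: I_def partial_dft_0\<close>)
  then show ?thesis
    by (rule ends_within_weaken) (auto simp: I_def partial_dft_final)
qed

section \<open>The discretised inner products as a filtered Fourier transform\<close>

text \<open>
  The normalising factor of the inner products combined with the denominator of the geometric sum.
\<close>

definition scale_factor :: "nat \<Rightarrow> nat \<Rightarrow> nat \<Rightarrow> complex" where
  "scale_factor M N s = complex_of_real (sqrt (1 - (radius M s)\<^sup>2)) /
     (of_nat N * (1 - complex_of_real (radius M s) ^ N))"

lemma radius_bounds: "s \<le> M \<Longrightarrow> 0 \<le> radius M s \<and> radius M s < 1"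
  by (simp add: radius_def)

lemma radius_power_neq_1:
  assumes "s \<le> M" "N > 0"
  shows "complex_of_real (radius M s) ^ N \<noteq> 1"
proof -
  have "radius M s ^ N < 1" using radius_bounds[OF assms(1)] assms(2) by (simp add: power_less_one_iff)
  then show ?thesis by (metis less_irrefl of_real_eq_1_iff of_real_power)
qed

lemma grid_point_eq: "grid_point M N s j = complex_of_real (radius M s) * node N j"
  by (simp add: grid_point_def node_def)

text \<open>
  Conjugate powers are obtained as powers with the natural exponent \<open>(N - l) mod N\<close>, because index
  expressions have no negative values.
\<close>

lemma node_reflect:
  assumes "N > 0" "l < N"
  shows "node N (m * ((N - l) mod N)) = cis (- (2 * pi * real m / real N)) ^ l"
proof -
  have "node N (m * ((N - l) mod N)) * node N (m * l) = node N (m * N)"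
    using assms by (simp add: node_mod flip: node_add distrib_left)
  then have "node N (m * ((N - l) mod N)) * node N m ^ l = 1"
    by (simp add: node_period flip: node_mult)
  moreover have "cis (- (2 * pi * real m / real N)) ^ l * node N m ^ l = 1"
    by (simp add: node_def cis_mult flip: power_mult_distrib)
  ultimately show ?thesis by (metis mult_cancel_right mult_zero_right zero_neq_one)
qed

lemma discrete_inner_eq_dft:
  assumes s: "s \<le> M" and N: "N > 0"
  shows "discrete_inner G M N s j = dft N (\<lambda>l. scale_factor M N s * complex_of_real (radius M s) ^ l *
           dft N (\<lambda>m. G (node N m)) ((N - l) mod N)) j"
proof -
  let ?r = "complex_of_real (radius M s)" and ?c = "\<lambda>m. cis (- (2 * pi * real m / real N))"
  \<comment> \<open>The kernel is a finite geometric sum, since \<open>z\<close> and \<open>r\<close> have the same \<open>N\<close>-th power.\<close>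
  have kernel: "1 / (1 - grid_point M N s j * ?c m) =
      (\<Sum>l<N. ?r ^ l * node N (l * j) * node N (m * ((N - l) mod N))) / (1 - ?r ^ N)" for m
  proof -
    let ?z = "grid_point M N s j * ?c m"
    have "cmod ?z < 1"
      using radius_bounds[OF s] by (simp add: grid_point_def norm_mult)
    then have z: "?z \<noteq> 1" by auto
    have "?c m ^ N = 1"
    proof -
      have "?c m ^ N * node N m ^ N = 1"
        by (simp add: node_def cis_mult flip: power_mult_distrib)
      then show ?thesis by (simp add: node_period flip: node_mult)
    qed
    moreover have "node N j ^ N = 1" by (simp add: node_period flip: node_mult)
    ultimately have "?z ^ N = ?r ^ N" by (simp add: grid_point_eq power_mult_distrib)
    moreover have "?z ^ l = ?r ^ l * node N (l * j) * node N (m * ((N - l) mod N))" if "l < N" for l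
      using node_reflect[OF N that] node_mult[of N j l]
      by (simp add: grid_point_eq power_mult_distrib mult.commute)
    ultimately show ?thesis
      using z sum_gp_strict[of ?z N] radius_power_neq_1[OF s N] by (simp add: field_simps)
  qed
  let ?w = "complex_of_real (sqrt (1 - (radius M s)\<^sup>2) / real N)"
  have "discrete_inner G M N s j = (\<Sum>m<N. \<Sum>l<N. ?w * G (node N m) *
      (?r ^ l * node N (l * j) * node N (m * ((N - l) mod N))) / (1 - ?r ^ N))"
    unfolding discrete_inner_def kernel lessThan_atLeast0[symmetric]
    by (simp add: sum_distrib_left sum_divide_distrib)
  also have "\<dots> = (\<Sum>l<N. \<Sum>m<N. ?w * G (node N m) *
      (?r ^ l * node N (l * j) * node N (m * ((N - l) mod N))) / (1 - ?r ^ N))"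
    by (rule sum.swap)
  also have "\<dots> = dft N (\<lambda>l. scale_factor M N s * ?r ^ l *
           dft N (\<lambda>m. G (node N m)) ((N - l) mod N)) j"
    unfolding dft_def sum_distrib_left sum_distrib_right
    by (intro sum.cong refl) (simp add: scale_factor_def mult_ac)
  finally show ?thesis .
qed

section \<open>The selection algorithm and its cost\<close>

text \<open>
  The conjugate transform of the samples, stored in the array \<open>H\<close>.
\<close>

definition transform_samples :: com where
  "transform_samples = Seq
     (for_loop ''l'' ''N'' (CAssign ''F'' (IVar ''l'') (CCell ''G'' (IVar ''l''))))
     (Seq fft
       (for_loop ''l'' ''N'' (CAssign ''H'' (IVar ''l'')
         (CCell ''F'' (IAdd (IMul (IVar ''K'') (IVar ''N''))
           (IMod (ISub (IVar ''N'') (IVar ''l'')) (IVar ''N'')))))))"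

lemma transform_samples_correct:
  assumes K: "\<sigma> ''K'' = K" and N: "\<sigma> ''N'' = 2 ^ K"
    and x: "\<And>i. i < 2 ^ K \<Longrightarrow> \<mu> ''G'' i = x i"
  shows "ends_within transform_samples (3 * K * 2 ^ K)
    (\<lambda>\<sigma>' \<mu>'. \<forall>l<2 ^ K. \<mu>' ''H'' l = dft (2 ^ K) x ((2 ^ K - l) mod 2 ^ K)) \<sigma> \<mu>"
proof -
  have "ends_within transform_samples (2 ^ K * 0 + (3 * K * 2 ^ K + 2 ^ K * 0))
    (\<lambda>\<sigma>' \<mu>'. \<forall>l<2 ^ K. \<mu>' ''H'' l = dft (2 ^ K) x ((2 ^ K - l) mod 2 ^ K)) \<sigma> \<mu>"
    unfolding transform_samples_def
  proof (rule ends_within_Seq, rule ends_within_for_loop[where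
        I = "\<lambda>i \<sigma>' \<mu>'. \<forall>i'<i. \<mu>' ''F'' i' = x i'" and n = "2 ^ K" and k = 0], goal_cases)
    case (5 i \<tau> \<nu>)
    then have "\<nu> ''G'' = \<mu> ''G''" by (simp add: unchanged_def)
    with 5(1,2,4) x show ?case by (intro ends_within_CAssign) (auto simp: less_Suc_eq)
  next
    case (6 \<tau> \<nu>)
    then have v: "\<tau> ''K'' = K" "\<tau> ''N'' = 2 ^ K" "\<And>i. i < 2 ^ K \<Longrightarrow> \<nu> ''F'' i = x i"
      using K N by (auto simp: unchanged_def)
    show ?case
    proof (rule ends_within_Seq[OF fft_correct[where x = x and \<mu> = \<nu>, OF v]], assumption, goal_cases)
      case (1 \<sigma>' \<mu>')
      then have w: "\<sigma>' ''K'' = K" "\<sigma>' ''N'' = 2 ^ K" using v by (auto simp: unchanged_def)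
      show ?case
      proof (rule ends_within_for_loop[where
            I = "\<lambda>l \<sigma>' \<mu>'. \<forall>i<l. \<mu>' ''H'' i = dft (2 ^ K) x ((2 ^ K - i) mod 2 ^ K)"], goal_cases)
        case (5 i \<tau>' \<nu>')
        have "(2 ^ K - i) mod 2 ^ K < (2 ^ K :: nat)" by simp
        with 1(1) have "\<mu>' ''F'' (K * 2 ^ K + (2 ^ K - i) mod 2 ^ K) =
            dft (2 ^ K) x ((2 ^ K - i) mod 2 ^ K)"
          by blast
        moreover have "\<tau>' ''K'' = K" "\<tau>' ''N'' = 2 ^ K" "\<nu>' ''F'' = \<mu>' ''F''"
          using 5(3) w by (simp_all add: unchanged_def)
        ultimately show ?case using 5(2,4)
          by (intro ends_within_CAssign) (simp_all add: less_Suc_eq)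
      qed (use w in auto)
    qed
  qed (use N in auto)
  then show ?thesis by simp
qed

text \<open>
  The next programs treat one circle.  The loop variable \<open>s\<close> starts at 0, so the circle is the one
  with radius \<open>radius M (s + 1)\<close>.  The radius goes to \<open>R\<close>, its powers up to the exponent \<open>N\<close> to \<open>P\<close>.
\<close>

definition filter_powers :: com where
  "filter_powers =
     Seq (CAssign ''R'' (INum 0)
           (CDiv (CNat (IAdd (IVar ''s'') (INum 1))) (CNat (IAdd (IVar ''M'') (INum 1)))))
    (Seq (CAssign ''P'' (INum 0) (CNat (INum 1)))
         (for_loop ''l'' ''N'' (CAssign ''P'' (IAdd (IVar ''l'') (INum 1))
           (CMul (CCell ''P'' (IVar ''l'')) (CCell ''R'' (INum 0))))))"

text \<open>
  The scale factor goes to \<open>S\<close> and the filtered spectrum to the input cells of the transform.  The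
  radicand \<open>1 - r\<^sup>2\<close> is written as a quotient of natural numbers.
\<close>

definition filter_load :: com where
  "filter_load =
     Seq (CAssign ''S'' (INum 0)
           (CDiv
             (CSqrt
               (ISub (IMul (IAdd (IVar ''M'') (INum 1)) (IAdd (IVar ''M'') (INum 1)))
                     (IMul (IAdd (IVar ''s'') (INum 1)) (IAdd (IVar ''s'') (INum 1))))
               (IMul (IAdd (IVar ''M'') (INum 1)) (IAdd (IVar ''M'') (INum 1))))
             (CMul (CNat (IVar ''N'')) (CSub (CNat (INum 1)) (CCell ''P'' (IVar ''N''))))))
         (for_loop ''l'' ''N'' (CAssign ''F'' (IVar ''l'')
           (CMul (CMul (CCell ''S'' (INum 0)) (CCell ''P'' (IVar ''l'')))
             (CCell ''H'' (IVar ''l'')))))"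

definition filter_store :: com where
  "filter_store = for_loop ''l'' ''N''
     (CAssign ''values'' (IAdd (IMul (IAdd (IVar ''s'') (INum 1)) (IVar ''N'')) (IVar ''l''))
       (CCell ''F'' (IAdd (IMul (IVar ''K'') (IVar ''N'')) (IVar ''l''))))"

definition filter_circle :: com where
  "filter_circle = Seq filter_powers (Seq filter_load (Seq fft filter_store))"

lemma filter_writes [simp]:
  "index_writes filter_powers = {''l''}" "array_writes filter_powers = {''R'', ''P''}"
  "index_writes filter_load = {''l''}" "array_writes filter_load = {''S'', ''F''}"
  "index_writes filter_store = {''l''}" "array_writes filter_store = {''values''}"
  "index_writes filter_circle = {''l'', ''D'', ''d'', ''i''}"
  "array_writes filter_circle = {''R'', ''P'', ''S'', ''F'', ''values''}"
  by (auto simp: filter_powers_def filter_load_def filter_store_def filter_circle_def)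

lemma filter_powers_correct:
  assumes M: "\<sigma> ''M'' = M" and s: "\<sigma> ''s'' = s" and N: "\<sigma> ''N'' = N"
  shows "ends_within filter_powers (4 + N)
    (\<lambda>\<sigma>' \<mu>'. \<forall>l\<le>N. \<mu>' ''P'' l = complex_of_real (radius M (Suc s)) ^ l) \<sigma> \<mu>"
proof -
  let ?r = "complex_of_real (radius M (Suc s))"
  let ?I = "\<lambda>l \<sigma>' \<mu>'. \<mu>' ''R'' 0 = ?r \<and> (\<forall>i\<le>l. \<mu>' ''P'' i = ?r ^ i)"
  have r: "(1 + complex_of_nat s) / (1 + complex_of_nat M) = ?r" "1 + complex_of_nat M \<noteq> 0"
    using of_nat_neq_0[of M, where ?'a = complex] by (simp_all add: radius_def add.commute)
  have "ends_within filter_powers (3 + (1 + N * 1)) (?I N) \<sigma> \<mu>"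
    unfolding filter_powers_def
    by (rule ends_within_CAssign_Seq; (rule ends_within_CAssign_Seq)?;
        (rule ends_within_for_loop[where I = ?I])?)
      (auto intro!: ends_within_CAssign simp: r M s N le_Suc_eq)
  then show ?thesis by (rule ends_within_weaken) auto
qed

lemma sqrt_radius:
  assumes "s \<le> M"
  shows "sqrt (real ((M + 1) * (M + 1) - s * s) / real ((M + 1) * (M + 1))) =
    sqrt (1 - (radius M s)\<^sup>2)"
proof -
  have "s * s \<le> (M + 1) * (M + 1)" using assms by (intro mult_mono) auto
  then have "real ((M + 1) * (M + 1) - s * s) = (real M + 1)\<^sup>2 - (real s)\<^sup>2"
    by (simp add: of_nat_diff power2_eq_square algebra_simps)
  moreover have "real ((M + 1) * (M + 1)) = (real M + 1)\<^sup>2"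
    by (simp add: power2_eq_square algebra_simps)
  ultimately show ?thesis
    by (simp add: radius_def diff_divide_distrib power_divide del: of_nat_mult of_nat_add)
qed

lemma filter_load_correct:
  assumes M: "\<sigma> ''M'' = M" and s: "\<sigma> ''s'' = s" "s < M" and N: "\<sigma> ''N'' = N" "N > 0"
    and P: "\<And>l. l \<le> N \<Longrightarrow> \<mu> ''P'' l = complex_of_real (radius M (Suc s)) ^ l"
  shows "ends_within filter_load (6 + 2 * N)
    (\<lambda>\<sigma>' \<mu>'. \<forall>l<N. \<mu>' ''F'' l =
       scale_factor M N (Suc s) * complex_of_real (radius M (Suc s)) ^ l * \<mu> ''H'' l) \<sigma> \<mu>"
proof -
  have ne: "complex_of_real (radius M (Suc s)) ^ N \<noteq> 1"
    using radius_power_neq_1[of "Suc s" M N] s N by simp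
  have sq: "sqrt (real ((M + 1) * (M + 1) - (s + 1) * (s + 1)) / real ((M + 1) * (M + 1))) =
    sqrt (1 - (radius M (Suc s))\<^sup>2)"
    using sqrt_radius[of "Suc s" M] s by simp
  let ?\<mu> = "\<mu>(''S'' := (\<mu> ''S'')(0 := scale_factor M N (Suc s)))"
  let ?I = "\<lambda>l \<sigma>' \<mu>'. \<forall>i<l. \<mu>' ''F'' i =
       scale_factor M N (Suc s) * complex_of_real (radius M (Suc s)) ^ i * \<mu> ''H'' i"
  have loop: "ends_within (for_loop ''l'' ''N'' (CAssign ''F'' (IVar ''l'')
           (CMul (CMul (CCell ''S'' (INum 0)) (CCell ''P'' (IVar ''l'')))
             (CCell ''H'' (IVar ''l''))))) (N * 2) (?I N) \<sigma> ?\<mu>"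
  proof (rule ends_within_for_loop[where I = ?I], goal_cases)
    case (5 i \<tau> \<nu>)
    then show ?case
      using N P by (auto intro!: ends_within_CAssign simp: unchanged_def less_Suc_eq)
  qed (use N in auto)
  have "ends_within filter_load (6 + N * 2) (?I N) \<sigma> \<mu>"
    unfolding filter_load_def
  proof (rule ends_within_CAssign_Seq, goal_cases)
    case 3
    show ?case using loop N P sq by (simp add: M s scale_factor_def del: of_nat_mult of_nat_add)
  qed (use N P ne in \<open>auto simp: M s\<close>)
  then show ?thesis by (simp add: mult.commute)
qed

lemma filter_store_correct:
  assumes K: "\<sigma> ''K'' = K" and N: "\<sigma> ''N'' = N" and s: "\<sigma> ''s'' = s"
  shows "ends_within filter_store 0
    (\<lambda>\<sigma>' \<mu>'. (\<forall>j<N. \<mu>' ''values'' (Suc s * N + j) = \<mu> ''F'' (K * N + j)) \<and>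
       (\<forall>i<Suc s * N. \<mu>' ''values'' i = \<mu> ''values'' i)) \<sigma> \<mu>"
proof -
  let ?I = "\<lambda>l \<sigma>' \<mu>'. (\<forall>j<l. \<mu>' ''values'' (Suc s * N + j) = \<mu> ''F'' (K * N + j)) \<and>
       (\<forall>i<Suc s * N. \<mu>' ''values'' i = \<mu> ''values'' i)"
  have "ends_within filter_store (N * 0) (?I N) \<sigma> \<mu>"
    unfolding filter_store_def
  proof (rule ends_within_for_loop[where I = ?I], goal_cases)
    case (5 j \<tau> \<nu>)
    then have "\<tau> ''K'' = K" "\<tau> ''N'' = N" "\<tau> ''s'' = s" "\<nu> ''F'' = \<mu> ''F''"
      using K N s by (simp_all add: unchanged_def)
    with 5(2,4) show ?case
      by (intro ends_within_CAssign) (simp_all add: less_Suc_eq)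
  qed (use N in auto)
  then show ?thesis by simp
qed

lemma filter_circle_correct:
  assumes K: "\<sigma> ''K'' = K" and N: "\<sigma> ''N'' = 2 ^ K" and M: "\<sigma> ''M'' = M"
    and s: "\<sigma> ''s'' = s" "s < M"
    and H: "\<And>l. l < 2 ^ K \<Longrightarrow>
      \<mu> ''H'' l = dft (2 ^ K) (\<lambda>m. G (node (2 ^ K) m)) ((2 ^ K - l) mod 2 ^ K)"
  shows "ends_within filter_circle (10 + 3 * 2 ^ K + 3 * K * 2 ^ K)
    (\<lambda>\<sigma>' \<mu>'. (\<forall>j<2 ^ K. \<mu>' ''values'' (Suc s * 2 ^ K + j) = discrete_inner G M (2 ^ K) (Suc s) j) \<and>
       (\<forall>i<Suc s * 2 ^ K. \<mu>' ''values'' i = \<mu> ''values'' i)) \<sigma> \<mu>"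
    (is "ends_within _ _ ?Q _ _")
proof -
  let ?r = "complex_of_real (radius M (Suc s))"
  let ?y = "\<lambda>l. scale_factor M (2 ^ K) (Suc s) * ?r ^ l * \<mu> ''H'' l"
  have y: "dft (2 ^ K) ?y j = discrete_inner G M (2 ^ K) (Suc s) j" for j
    using discrete_inner_eq_dft[of "Suc s" M "2 ^ K" G j] s H by (simp add: dft_def)
  have "ends_within filter_circle ((4 + 2 ^ K) + ((6 + 2 * 2 ^ K) + (3 * K * 2 ^ K + 0))) ?Q \<sigma> \<mu>"
    unfolding filter_circle_def
  proof (rule ends_within_Seq[OF filter_powers_correct[OF M s(1) N]], goal_cases)
    case (1 \<sigma>1 \<mu>1)
    then have v: "\<sigma>1 ''K'' = K" "\<sigma>1 ''N'' = 2 ^ K" "\<sigma>1 ''M'' = M" "\<sigma>1 ''s'' = s"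
      and P: "\<And>l. l \<le> 2 ^ K \<Longrightarrow> \<mu>1 ''P'' l = ?r ^ l"
      and H1: "\<mu>1 ''H'' = \<mu> ''H''" "\<mu>1 ''values'' = \<mu> ''values''"
      using K N M s by (auto simp: unchanged_def)
    show ?case
    proof (rule ends_within_Seq[OF filter_load_correct[where \<mu> = \<mu>1, OF v(3,4) s(2) v(2) _ P]], goal_cases)
      case (3 \<sigma>2 \<mu>2)
      then have w: "\<sigma>2 ''K'' = K" "\<sigma>2 ''N'' = 2 ^ K" "\<sigma>2 ''s'' = s"
        and F: "\<And>l. l < 2 ^ K \<Longrightarrow> \<mu>2 ''F'' l = ?y l"
        and H2: "\<mu>2 ''values'' = \<mu> ''values''"
        using v H1 by (auto simp: unchanged_def)
      show ?case
      proof (rule ends_within_Seq[OF fft_correct[where x = ?y and \<mu> = \<mu>2, OF w(1,2) F]], assumption, goal_cases)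
        case (1 \<sigma>3 \<mu>3)
        then have "\<sigma>3 ''K'' = K" "\<sigma>3 ''N'' = 2 ^ K" "\<sigma>3 ''s'' = s" using w by (auto simp: unchanged_def)
        from filter_store_correct[OF this] show ?case
          by (rule ends_within_weaken) (use 1 y H2 in \<open>auto simp: unchanged_def\<close>)
      qed
    qed auto
  qed
  then show ?thesis by (rule ends_within_weaken) auto
qed

definition all_circles :: com where
  "all_circles = for_loop ''s'' ''M'' filter_circle"

lemma all_circles_writes [simp]:
  "index_writes all_circles = {''s'', ''l'', ''D'', ''d'', ''i''}"
  "array_writes all_circles = {''R'', ''P'', ''S'', ''F'', ''values''}"
  by (auto simp: all_circles_def)

lemma all_circles_correct:
  assumes K: "\<sigma> ''K'' = K" and N: "\<sigma> ''N'' = 2 ^ K" and M: "\<sigma> ''M'' = M"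
    and H: "\<And>l. l < 2 ^ K \<Longrightarrow>
      \<mu> ''H'' l = dft (2 ^ K) (\<lambda>m. G (node (2 ^ K) m)) ((2 ^ K - l) mod 2 ^ K)"
  shows "ends_within all_circles (M * (10 + 3 * 2 ^ K + 3 * K * 2 ^ K))
    (\<lambda>\<sigma>' \<mu>'. \<forall>s\<in>{1..M}. \<forall>j<2 ^ K. \<mu>' ''values'' (s * 2 ^ K + j) = discrete_inner G M (2 ^ K) s j) \<sigma> \<mu>"
proof -
  let ?I = "\<lambda>n \<sigma>' \<mu>'. \<forall>s\<in>{1..n}. \<forall>j<2 ^ K.
    \<mu>' ''values'' (s * 2 ^ K + j) = discrete_inner G M (2 ^ K) s j"
  show ?thesis
    unfolding all_circles_def
  proof (rule ends_within_for_loop[where I = ?I], goal_cases)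
    case (5 s \<tau> \<nu>)
    then have v: "\<tau> ''K'' = K" "\<tau> ''N'' = 2 ^ K" "\<tau> ''M'' = M" "\<nu> ''H'' = \<mu> ''H''"
      using K N M by (auto simp: unchanged_def)
    show ?case
    proof (rule ends_within_weaken[OF filter_circle_correct[where G = G and \<mu> = \<nu>, OF v(1-3) 5(2,1)]], goal_cases)
      case (2 \<sigma>' \<mu>')
      \<comment> \<open>The values for the earlier circles lie in lower cells, which are not written again.\<close>
      have "\<mu>' ''values'' (t * 2 ^ K + j) = \<nu> ''values'' (t * 2 ^ K + j)"
        if "t \<le> s" "j < 2 ^ K" for t j
      proof -
        have "t * 2 ^ K + j < Suc s * 2 ^ K"
          using mult_right_mono[OF that(1), of "2 ^ K :: nat"] that(2) unfolding mult_Suc by linarith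
        then show ?thesis using 2 by blast
      qed
      then show ?case using 2 5(4) by (auto simp: le_Suc_eq)
    qed (use H v in auto)
  qed (use M in auto)
qed

text \<open>
  Linear search for a value of maximal modulus in the cells \<open>N, \<dots>, N + T - 1\<close> of \<open>values\<close>, which for
  \<open>T = M * N\<close> hold the values for \<open>s = 1, \<dots>, M\<close>.  The index of the best cell is kept in \<open>b\<close>.
\<close>

definition find_maximum :: com where
  "find_maximum =
     Seq (IAssign ''b'' (IVar ''N''))
         (for_loop ''t'' ''T'' (Cond
           (BAbsLess (CCell ''values'' (IVar ''b'')) (CCell ''values'' (IAdd (IVar ''N'') (IVar ''t''))))
           (IAssign ''b'' (IAdd (IVar ''N'') (IVar ''t'')))
           Skip))"

lemma find_maximum_writes [simp]:
  "index_writes find_maximum = {''b'', ''t''}" "array_writes find_maximum = {}"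
  by (auto simp: find_maximum_def)

lemma find_maximum_correct:
  assumes N: "\<sigma> ''N'' = N" and T: "\<sigma> ''T'' = T" "T > 0"
  shows "ends_within find_maximum T
    (\<lambda>\<sigma>' \<mu>'. \<sigma>' ''b'' \<in> {N..<N + T} \<and>
       (\<forall>i\<in>{N..<N + T}. cmod (\<mu> ''values'' i) \<le> cmod (\<mu> ''values'' (\<sigma>' ''b'')))) \<sigma> \<mu>"
proof -
  let ?I = "\<lambda>t \<sigma>' (\<mu>'::cstore). \<sigma>' ''b'' \<in> {N..<N + T} \<and>
       (\<forall>i\<in>{N..<N + t}. cmod (\<mu> ''values'' i) \<le> cmod (\<mu> ''values'' (\<sigma>' ''b'')))"
  have "ends_within find_maximum (T * 1) (?I T) \<sigma> \<mu>"
    unfolding find_maximum_def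
  proof (rule ends_within_IAssign_Seq, rule ends_within_for_loop[where I = ?I], goal_cases)
    case (5 t \<tau> \<nu>)
    then have v: "\<tau> ''N'' = N" "\<nu> ''values'' = \<mu> ''values''" using N by (auto simp: unchanged_def)
    have b: "\<tau> ''b'' \<in> {N..<N + T}" and t: "\<tau> ''t'' = t" "t < T"
      and max: "\<And>i. N \<le> i \<Longrightarrow> i < N + t \<Longrightarrow> cmod (\<mu> ''values'' i) \<le> cmod (\<mu> ''values'' (\<tau> ''b''))"
      using 5(1,2,4) by auto
    show ?case
    proof (rule ends_within_Cond[where l = 0], goal_cases)
      case 3
      then have le: "cmod (\<mu> ''values'' (\<tau> ''b'')) \<le> cmod (\<mu> ''values'' (N + t))" by (simp add: v t)
      have "cmod (\<mu> ''values'' i) \<le> cmod (\<mu> ''values'' (N + t))" if "N \<le> i" "i < N + Suc t" for i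
        using that le max[of i] by (cases "i = N + t") auto
      with t show ?case by (intro ends_within_IAssign) (simp add: v)
    next
      case 4
      then have "cmod (\<mu> ''values'' (N + t)) \<le> cmod (\<mu> ''values'' (\<tau> ''b''))" by (simp add: v t)
      with max have "cmod (\<mu> ''values'' i) \<le> cmod (\<mu> ''values'' (\<tau> ''b''))" if "N \<le> i" "i < N + Suc t" for i
        using that by (cases "i = N + t") auto
      with b show ?case by (intro ends_within_Skip) simp
    qed simp_all
  qed (use N T in auto)
  then show ?thesis by simp
qed

definition set_sizes :: com where
  "set_sizes = Seq (IAssign ''N'' (INum 1))
     (Seq (for_loop ''i'' ''K'' (IAssign ''N'' (IMul (INum 2) (IVar ''N''))))
          (IAssign ''T'' (IMul (IVar ''M'') (IVar ''N''))))"

lemma set_sizes_writes [simp]: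
  "index_writes set_sizes = {''N'', ''i'', ''T''}" "array_writes set_sizes = {}"
  by (auto simp: set_sizes_def)

lemma set_sizes_correct:
  assumes K: "\<sigma> ''K'' = K" and M: "\<sigma> ''M'' = M"
  shows "ends_within set_sizes 0 (\<lambda>\<sigma>' \<mu>'. \<sigma>' ''N'' = 2 ^ K \<and> \<sigma>' ''T'' = M * 2 ^ K) \<sigma> \<mu>"
proof -
  have "ends_within set_sizes (K * 0 + 0) (\<lambda>\<sigma>' \<mu>'. \<sigma>' ''N'' = 2 ^ K \<and> \<sigma>' ''T'' = M * 2 ^ K) \<sigma> \<mu>"
    unfolding set_sizes_def
  proof (rule ends_within_IAssign_Seq, rule ends_within_Seq,
      rule ends_within_for_loop[where I = "\<lambda>i \<sigma>' \<mu>'. \<sigma>' ''N'' = 2 ^ i"], goal_cases)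
    case (5 i \<tau> \<nu>)
    then show ?case by (intro ends_within_IAssign) simp
  next
    case (6 \<tau> \<nu>)
    then have "\<tau> ''M'' = M" using M by (simp add: unchanged_def)
    with 6(1) show ?case by (intro ends_within_IAssign) simp
  qed (use K in simp_all)
  then show ?thesis by simp
qed

text \<open>
  The complete algorithm.  The cell index \<open>b = s * N + j\<close> of the maximum is decoded by division with
  remainder, and the point is computed from \<open>s\<close> and \<open>j\<close>.
\<close>

definition maximal_selection :: com where
  "maximal_selection =
     Seq set_sizes (Seq transform_samples (Seq all_circles (Seq find_maximum
       (CAssign ''point'' (INum 0)
         (CMul (CDiv (CNat (IDiv (IVar ''b'') (IVar ''N''))) (CNat (IAdd (IVar ''M'') (INum 1))))
           (CRoot (IMod (IVar ''b'') (IVar ''N'')) (IVar ''N'')))))))"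


lemma maximal_selection_correct:
  assumes K: "\<sigma> ''K'' = K" and M: "\<sigma> ''M'' = M" "M \<ge> 1" and N: "N = 2 ^ K"
    and G: "\<And>m. m < N \<Longrightarrow> \<mu> ''G'' m = G (node N m)"
  shows "ends_within maximal_selection (3 * K * N + M * (10 + 4 * N + 3 * K * N) + 5)
    (\<lambda>\<sigma>' \<mu>'. (\<forall>s\<in>{1..M}. \<forall>j<N. \<mu>' ''values'' (s * N + j) = discrete_inner G M N s j) \<and>
       (\<exists>s'\<in>{1..M}. \<exists>j'<N. \<mu>' ''point'' 0 = grid_point M N s' j' \<and>
          (\<forall>s\<in>{1..M}. \<forall>j<N. cmod (discrete_inner G M N s j) \<le> cmod (discrete_inner G M N s' j')))) \<sigma> \<mu>"
    (is "ends_within _ _ ?Q _ _")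
proof -
  have "ends_within maximal_selection
      (0 + (3 * K * N + (M * (10 + 3 * 2 ^ K + 3 * K * 2 ^ K) + (M * N + 5)))) ?Q \<sigma> \<mu>"
    unfolding maximal_selection_def
  proof (rule ends_within_Seq[OF set_sizes_correct[OF K M(1)]], goal_cases)
    case (1 \<sigma>1 \<mu>1)
    then have v1: "\<sigma>1 ''K'' = K" "\<sigma>1 ''N'' = 2 ^ K" "\<sigma>1 ''M'' = M" "\<sigma>1 ''T'' = M * N"
      and G1: "\<And>m. m < 2 ^ K \<Longrightarrow> \<mu>1 ''G'' m = G (node N m)"
      using K M G by (auto simp: unchanged_def N)
    show ?case unfolding N
    proof (rule ends_within_Seq[OF transform_samples_correct[where \<mu> = \<mu>1 and
          x = "\<lambda>m. G (node N m)", OF v1(1,2) G1]], assumption, goal_cases)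
      case (1 \<sigma>2 \<mu>2)
      then have v2: "\<sigma>2 ''K'' = K" "\<sigma>2 ''N'' = 2 ^ K" "\<sigma>2 ''M'' = M" "\<sigma>2 ''T'' = M * N"
        and H: "\<And>l. l < 2 ^ K \<Longrightarrow>
            \<mu>2 ''H'' l = dft (2 ^ K) (\<lambda>m. G (node (2 ^ K) m)) ((2 ^ K - l) mod 2 ^ K)"
        using v1 by (auto simp: unchanged_def transform_samples_def N)
      show ?case
      proof (rule ends_within_Seq[OF all_circles_correct[where \<mu> = \<mu>2 and G = G, OF v2(1-3) H]],
          assumption, goal_cases)
        case (1 \<sigma>3 \<mu>3)
        then have v3: "\<sigma>3 ''N'' = N" "\<sigma>3 ''M'' = M" "\<sigma>3 ''T'' = M * N"
          and V: "\<And>s j. s \<in> {1..M} \<Longrightarrow> j < N \<Longrightarrow> \<mu>3 ''values'' (s * N + j) = discrete_inner G M N s j"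
          using v2 by (auto simp: unchanged_def N)
        have pos: "M * N > 0" using M N by simp
        show ?case unfolding N[symmetric]
        proof (rule ends_within_Seq[OF find_maximum_correct[OF v3(1,3) pos]], goal_cases)
          case (1 \<sigma>4 \<mu>4)
          then have v4: "\<sigma>4 ''N'' = N" "\<sigma>4 ''M'' = M" "\<mu>4 ''values'' = \<mu>3 ''values''"
            using v3 by (auto simp: unchanged_def)
          define s' j' where "s' = \<sigma>4 ''b'' div N" and "j' = \<sigma>4 ''b'' mod N"
          have b: "\<sigma>4 ''b'' = s' * N + j'" by (simp add: s'_def j'_def)
          have j': "j' < N" using N by (simp add: j'_def)
          have s': "s' \<in> {1..M}"
          proof -
            have "s' < Suc M" unfolding s'_def by (rule less_mult_imp_div_less) (use 1 in auto)
            moreover have "s' \<ge> 1" unfolding s'_def using 1 N by (simp add: Suc_le_eq div_greater_zero_iff)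
            ultimately show ?thesis by simp
          qed
          have max: "cmod (discrete_inner G M N s j) \<le> cmod (discrete_inner G M N s' j')"
            if "s \<in> {1..M}" "j < N" for s j
          proof -
            have "1 * N \<le> s * N" "s * N \<le> M * N"
              using that by (intro mult_right_mono; simp)+
            then have "s * N + j \<in> {N..<N + M * N}"
              unfolding atLeastLessThan_iff using that(2) by linarith
            then have "cmod (\<mu>3 ''values'' (s * N + j)) \<le> cmod (\<mu>3 ''values'' (\<sigma>4 ''b''))"
              using 1(1) by blast
            then show ?thesis unfolding b V[OF that] V[OF s' j'] .
          qed
          have ne: "1 + complex_of_nat M \<noteq> 0"
            using of_nat_neq_0[of M, where ?'a = complex] by simp
          have "complex_of_nat s' * cis (2 * pi * real j' / real N) / (1 + complex_of_nat M) =
              grid_point M N s' j'"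
            by (simp add: grid_point_eq radius_def node_def add.commute)
          then have best: "\<exists>s\<in>{1..M}. \<exists>j<N.
              complex_of_nat s' * cis (2 * pi * real j' / real N) / (1 + complex_of_nat M) =
                grid_point M N s j \<and>
              (\<forall>t\<in>{1..M}. \<forall>i<N. cmod (discrete_inner G M N t i) \<le> cmod (discrete_inner G M N s j))"
            using s' j' max by (intro bexI[of _ s'] exI[of _ j'] conjI ballI allI impI)
          show ?case
            by (rule ends_within_CAssign)
              (use j' ne v4 V best in \<open>auto simp flip: s'_def j'_def\<close>)
        qed
      qed
    qed
  qed
  then show ?thesis by (rule ends_within_weaken) (auto simp: N algebra_simps)
qed

theorem mainTheorem2:
  "\<exists>(P :: com) (C :: real). \<forall>(K :: nat) (M :: nat) (N :: nat) (G :: complex \<Rightarrow> complex).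
     K \<ge> 1 \<longrightarrow> M \<ge> 1 \<longrightarrow> N = 2 ^ K \<longrightarrow>
     (\<exists>n \<sigma> \<mu>.
        runs P (input_state K M (\<lambda>m. G (node N m))) n (\<sigma>, \<mu>) \<and>
        (\<forall>s\<in>{1..M}. \<forall>j\<in>{0..<N}. \<mu> ''values'' (s * N + j) = discrete_inner G M N s j) \<and>
        (\<exists>s'\<in>{1..M}. \<exists>j'\<in>{0..<N}.
           \<mu> ''point'' 0 = grid_point M N s' j' \<and>
           (cmod (discrete_inner G M N s' j'))\<^sup>2 =
             Max ((\<lambda>(s, j). (cmod (discrete_inner G M N s j))\<^sup>2) ` ({1..M} \<times> {0..<N}))) \<and>
        real n \<le> C * (real M * real N * log 2 (real N)))"
proof (intro exI[of _ maximal_selection] exI[of _ "25 :: real"] allI impI)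
  fix K M N :: nat and G :: "complex \<Rightarrow> complex"
  assume K: "K \<ge> 1" and M: "M \<ge> 1" and N: "N = 2 ^ K"
  let ?d = "discrete_inner G M N"
  obtain \<sigma>0 \<mu>0 where init: "input_state K M (\<lambda>m. G (node N m)) = (\<sigma>0, \<mu>0)"
    by (cases "input_state K M (\<lambda>m. G (node N m))")
  then have "\<sigma>0 ''K'' = K" "\<sigma>0 ''M'' = M" "\<And>m. m < N \<Longrightarrow> \<mu>0 ''G'' m = G (node N m)"
    by (auto simp: input_state_def N)
  from maximal_selection_correct[where \<mu> = \<mu>0 and G = G, OF this(1,2) M N this(3)]
  obtain n \<sigma> \<mu> s' j' where run: "runs maximal_selection (\<sigma>0, \<mu>0) n (\<sigma>, \<mu>)"
    and n: "n \<le> 3 * K * N + M * (10 + 4 * N + 3 * K * N) + 5"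
    and vals: "\<forall>s\<in>{1..M}. \<forall>j<N. \<mu> ''values'' (s * N + j) = ?d s j"
    and s'j': "s' \<in> {1..M}" "j' < N" and point: "\<mu> ''point'' 0 = grid_point M N s' j'"
    and max: "\<And>s j. s \<in> {1..M} \<Longrightarrow> j < N \<Longrightarrow> cmod (?d s j) \<le> cmod (?d s' j')"
    unfolding ends_within_def by blast
  have "(cmod (?d s' j'))\<^sup>2 = Max ((\<lambda>(s, j). (cmod (?d s j))\<^sup>2) ` ({1..M} \<times> {0..<N}))"
    by (rule Max_eqI[symmetric]) (use s'j' max in \<open>auto intro!: power_mono\<close>)
  moreover have "real n \<le> 25 * (real M * real N * log 2 (real N))"
  proof -
    \<comment> \<open>The cost bound is dominated termwise by multiples of \<open>M * K * N\<close>: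
      \<open>3 + 10 + 4 + 3 + 5 = 25\<close>.\<close>
    have "1 * 1 \<le> K * N" "1 * (K * N) \<le> M * (K * N)" "M * (1 * 1) \<le> M * (K * N)" "M * (1 * N) \<le> M * (K * N)"
      using K M by (intro mult_mono; simp add: N)+
    moreover have "n \<le> 3 * (K * N) + (10 * M + 4 * (M * N) + 3 * (M * (K * N))) + 5"
      using n by (simp add: algebra_simps)
    ultimately have "n \<le> 25 * (M * (K * N))" by linarith
    moreover have "log 2 (real N) = real K" by (simp add: N)
    ultimately show ?thesis
      by (metis (no_types, lifting) mult.assoc mult.commute of_nat_le_iff of_nat_mult of_nat_numeral)
  qed
  ultimately show "\<exists>n \<sigma> \<mu>.
        runs maximal_selection (input_state K M (\<lambda>m. G (node N m))) n (\<sigma>, \<mu>) \<and>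
        (\<forall>s\<in>{1..M}. \<forall>j\<in>{0..<N}. \<mu> ''values'' (s * N + j) = discrete_inner G M N s j) \<and>
        (\<exists>s'\<in>{1..M}. \<exists>j'\<in>{0..<N}.
           \<mu> ''point'' 0 = grid_point M N s' j' \<and>
           (cmod (discrete_inner G M N s' j'))\<^sup>2 =
             Max ((\<lambda>(s, j). (cmod (discrete_inner G M N s j))\<^sup>2) ` ({1..M} \<times> {0..<N}))) \<and>
        real n \<le> 25 * (real M * real N * log 2 (real N))"
    using run vals s'j' point unfolding init
    by (intro exI[of _ n] exI[of _ \<sigma>] exI[of _ \<mu>] conjI bexI[of _ s'] bexI[of _ j']) simp_all
qed

end
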